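(* Let $\mathcal{H}$ be a Hilbert space, let $A\in\mathcal{B}(\mathcal{H})$ satisfy $0\le A\le 1$ and $\ker A=\{0\}$, and let $\mathcal{B}^A_s(\mathcal{H})=\{B\in\mathcal{B}(\mathcal{H}): B^*A=AB\}$. Consider on the Hilbert space $\mathcal{H}\times\mathcal{H}$ the operator $A_0=\begin{pmatrix} 0 & A\\ 0 & 0\end{pmatrix}$. Then the real subspace $\mathcal{B}^A_s(\mathcal{H})$ is complemented in $\mathcal{B}(\mathcal{H})$ if and only if the commutant $\{B\in\mathcal{B}(\mathcal{H}\times\mathcal{H}): BA_0=A_0B\}$ of $A_0$ is complemented, as a complex subspace, in $\mathcal{B}(\mathcal{H}\times\mathcal{H})$.
   Context: $\mathcal{H}$ is a complex Hilbert space and $\mathcal{B}(\mathcal{H})$ is the Banach space of bounded operators on $\mathcal{H}$ with the operator norm. The adjoint $B^*$ is taken with respect to the original inner product of $\mathcal{H}$. The operators in $\mathcal{B}^A_s(\mathcal{H})$, called $A$-symmetric, are those which are symmetric for the inner product $[f,g]=\langle Af,g\rangle$. A closed (real, respectively complex) subspace $M$ of a Banach space $E$ is complemented if there is a closed (real, respectively complex) subspace $N$ with $E=M\oplus N$; the complementation of $\mathcal{B}^A_s(\mathcal{H})$ is understood for $\mathcal{B}(\mathcal{H})$ regarded as a real Banach space. *)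

theory Defs
  imports "HOL-Analysis.Analysis"
begin

class scaleC = scaleR +
  fixes scaleC :: "complex \<Rightarrow> 'a \<Rightarrow> 'a" (infixr \<open>*\<^sub>C\<close> 75)

class complex_vector = scaleC + real_vector +
  assumes scaleC_add_right: "a *\<^sub>C (x + y) = a *\<^sub>C x + a *\<^sub>C y"
    and scaleC_add_left: "(a + b) *\<^sub>C x = a *\<^sub>C x + b *\<^sub>C x"
    and scaleC_scaleC: "a *\<^sub>C b *\<^sub>C x = (a * b) *\<^sub>C x"
    and scaleR_scaleC: "r *\<^sub>R x = complex_of_real r *\<^sub>C x"

class complex_normed_vector = complex_vector + real_normed_vector +
  assumes norm_scaleC: "norm (a *\<^sub>C x) = cmod a * norm x"

text \<open>
  The complex inner product is linear in its first argument.  The underlying real inner product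
  is its real part; since the former is hermitian, the norm of \<^class>\<open>real_inner\<close>
  satisfies \<open>(norm x)\<^sup>2 = cinner x x\<close>, and positive definiteness is inherited.
\<close>
class complex_inner = complex_vector + real_inner +
  fixes cinner :: "'a \<Rightarrow> 'a \<Rightarrow> complex"
  assumes cinner_commute: "cinner x y = cnj (cinner y x)"
    and cinner_add_left: "cinner (x + y) z = cinner x z + cinner y z"
    and cinner_scaleC_left: "cinner (a *\<^sub>C x) y = a * cinner x y"
    and inner_eq_Re_cinner: "x \<bullet> y = Re (cinner x y)"
begin

lemma cinner_self: "cinner x x = complex_of_real ((norm x)\<^sup>2)"
proof (rule complex_eqI)
  show "Re (cinner x x) = Re (complex_of_real ((norm x)\<^sup>2))"
    by (simp add: power2_norm_eq_inner inner_eq_Re_cinner)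
  show "Im (cinner x x) = Im (complex_of_real ((norm x)\<^sup>2))"
    using arg_cong[OF cinner_commute[of x x], of Im] by simp
qed

lemma cinner_scaleC_right: "cinner x (a *\<^sub>C y) = cnj a * cinner x y"
  by (metis cinner_commute cinner_scaleC_left complex_cnj_mult)

subclass complex_normed_vector
proof
  fix a x
  have "complex_of_real ((norm (a *\<^sub>C x))\<^sup>2) = complex_of_real ((cmod a * norm x)\<^sup>2)"
    using complex_norm_square[of a]
    by (simp add: cinner_self[symmetric] cinner_scaleC_left cinner_scaleC_right
        power_mult_distrib mult.assoc[symmetric] del: of_real_power)
  then have "(norm (a *\<^sub>C x))\<^sup>2 = (cmod a * norm x)\<^sup>2"
    using of_real_eq_iff by blast
  then show "norm (a *\<^sub>C x) = cmod a * norm x"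
    by (simp add: power2_eq_iff_nonneg)
qed

end

class chilbert_space = complex_inner + complete_space

instance chilbert_space \<subseteq> banach ..

lemma cinner_eqI:
  fixes u v :: "'a::complex_inner"
  assumes "\<And>x. cinner x u = cinner x v"
  shows "u = v"
proof -
  have "x \<bullet> u = x \<bullet> v" for x
    using assms by (simp add: inner_eq_Re_cinner)
  then show ?thesis
    by (metis vector_eq_rdot inner_commute)
qed

instantiation prod :: (complex_vector, complex_vector) complex_vector
begin

definition scaleC_prod :: "complex \<Rightarrow> 'a \<times> 'b \<Rightarrow> 'a \<times> 'b"
  where "scaleC_prod c p = (c *\<^sub>C fst p, c *\<^sub>C snd p)"

instance
  by standard
    (auto simp: scaleC_prod_def prod_eq_iff scaleC_add_right scaleC_add_left scaleC_scaleC
      scaleR_scaleC)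

end

instantiation prod :: (complex_inner, complex_inner) complex_inner
begin

definition cinner_prod :: "'a \<times> 'b \<Rightarrow> 'a \<times> 'b \<Rightarrow> complex"
  where "cinner_prod p q = cinner (fst p) (fst q) + cinner (snd p) (snd q)"

instance
proof
  fix x y z :: "'a \<times> 'b" and a :: complex
  show "cinner x y = cnj (cinner y x)"
    unfolding cinner_prod_def
    using cinner_commute[of "fst x" "fst y"] cinner_commute[of "snd x" "snd y"] by simp
qed (auto simp: cinner_prod_def scaleC_prod_def cinner_add_left cinner_scaleC_left
      inner_prod_def inner_eq_Re_cinner algebra_simps)

end

instance prod :: (chilbert_space, chilbert_space) chilbert_space ..

instantiation blinfun :: (real_normed_vector, complex_normed_vector) complex_normed_vector
begin

lift_definition scaleC_blinfun :: "complex \<Rightarrow> 'a \<Rightarrow>\<^sub>L 'b \<Rightarrow> 'a \<Rightarrow>\<^sub>L 'b"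
  is "\<lambda>c f x. c *\<^sub>C f x"
proof -
  fix c and f :: "'a \<Rightarrow> 'b"
  assume f: "bounded_linear f"
  then obtain K where K: "\<And>x. norm (f x) \<le> norm x * K"
    using bounded_linear.bounded by blast
  show "bounded_linear (\<lambda>x. c *\<^sub>C f x)"
  proof (rule bounded_linear_intro[where K = "cmod c * K"])
    show "c *\<^sub>C f (x + y) = c *\<^sub>C f x + c *\<^sub>C f y" for x y
      using f by (simp add: bounded_linear.linear linear_add scaleC_add_right)
    show "c *\<^sub>C f (r *\<^sub>R x) = r *\<^sub>R c *\<^sub>C f x" for r x
      using f by (simp add: bounded_linear.linear linear_scale scaleR_scaleC scaleC_scaleC mult.commute)
    show "norm (c *\<^sub>C f x) \<le> norm x * (cmod c * K)" for x
      using mult_left_mono[OF K[of x], of "cmod c"] by (simp add: norm_scaleC mult.left_commute)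
  qed
qed

instance
proof
  fix a b :: complex and r :: real and x y :: "'a \<Rightarrow>\<^sub>L 'b"
  show "a *\<^sub>C (x + y) = a *\<^sub>C x + a *\<^sub>C y"
    by transfer (simp add: scaleC_add_right)
  show "(a + b) *\<^sub>C x = a *\<^sub>C x + b *\<^sub>C x"
    by transfer (simp add: scaleC_add_left)
  show "a *\<^sub>C b *\<^sub>C x = (a * b) *\<^sub>C x"
    by transfer (simp add: scaleC_scaleC)
  show "r *\<^sub>R x = complex_of_real r *\<^sub>C x"
    by transfer (simp add: scaleR_scaleC)
  have le: "norm (c *\<^sub>C z) \<le> cmod c * norm z" for c and z :: "'a \<Rightarrow>\<^sub>L 'b"
    by (rule norm_blinfun_bound)
      (auto simp: scaleC_blinfun.rep_eq norm_scaleC mult.assoc intro!: mult_left_mono norm_blinfun)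
  show "norm (a *\<^sub>C x) = cmod a * norm x"
  proof (cases "a = 0")
    case True
    then show ?thesis using le[of a x] by simp
  next
    case False
    have "inverse a *\<^sub>C a *\<^sub>C x = x"
      using False by transfer (simp add: scaleC_scaleC scaleR_scaleC[of 1, simplified, symmetric])
    then have "norm x \<le> inverse (cmod a) * norm (a *\<^sub>C x)"
      using le[of "inverse a" "a *\<^sub>C x"] by (simp add: norm_inverse)
    then have "cmod a * norm x \<le> norm (a *\<^sub>C x)"
      using False by (simp add: field_simps)
    then show ?thesis using le[of a x] by simp
  qed
qed

end

text \<open>
  The Banach space of bounded complex-linear operators is the following closed subspace of the
  bounded real-linear operators, whose norm is the operator norm.
\<close>
definition cbounded_ops :: "('a::complex_normed_vector \<Rightarrow>\<^sub>L 'a) set"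
  where "cbounded_ops = {B. \<forall>c x. blinfun_apply B (c *\<^sub>C x) = c *\<^sub>C B x}"

lemma closed_cbounded_ops: "closed (cbounded_ops :: ('a::complex_normed_vector \<Rightarrow>\<^sub>L 'a) set)"
proof -
  have "cbounded_ops = (\<Inter>c. \<Inter>x. {B::'a \<Rightarrow>\<^sub>L 'a. B (c *\<^sub>C x) = (c *\<^sub>C id_blinfun) (B x)})"
    by (auto simp: cbounded_ops_def scaleC_blinfun.rep_eq)
  also have "closed \<dots>"
    by (intro closed_INT ballI closed_Collect_eq continuous_intros)
  finally show ?thesis .
qed

text \<open>Meaningful on Hilbert spaces, where every bounded operator has exactly one adjoint.\<close>
definition cadjoint :: "('a::complex_inner \<Rightarrow>\<^sub>L 'a) \<Rightarrow> 'a \<Rightarrow>\<^sub>L 'a"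
  where "cadjoint B = (THE C. \<forall>x y. cinner (B x) y = cinner x (blinfun_apply C y))"

lemma cadjoint_eqI:
  assumes "\<And>x y. cinner (blinfun_apply B x) y = cinner x (blinfun_apply C y)"
  shows "cadjoint B = C"
  unfolding cadjoint_def
proof (rule the_equality)
  fix D :: "'a \<Rightarrow>\<^sub>L 'a"
  assume "\<forall>x y. cinner (B x) y = cinner x (D y)"
  then show "D = C"
    using assms by (intro blinfun_eqI cinner_eqI) metis
qed (use assms in blast)

definition op_le :: "('a::complex_inner \<Rightarrow>\<^sub>L 'a) \<Rightarrow> ('a \<Rightarrow>\<^sub>L 'a) \<Rightarrow> bool"
  where "op_le S T \<longleftrightarrow> (\<forall>x. cinner ((T - S) x) x \<in> \<real> \<and> 0 \<le> Re (cinner ((T - S) x) x))"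

definition symmetric_ops :: "('a::complex_inner \<Rightarrow>\<^sub>L 'a) \<Rightarrow> ('a \<Rightarrow>\<^sub>L 'a) set"
  where "symmetric_ops A = {B \<in> cbounded_ops. cadjoint B o\<^sub>L A = A o\<^sub>L B}"

definition commutant :: "('a::complex_normed_vector \<Rightarrow>\<^sub>L 'a) \<Rightarrow> ('a \<Rightarrow>\<^sub>L 'a) set"
  where "commutant T = {B \<in> cbounded_ops. B o\<^sub>L T = T o\<^sub>L B}"

text \<open>The operator matrix with rows \<open>P, Q\<close> and \<open>R, S\<close>, acting on column vectors.\<close>
lift_definition block_op ::
  "('a::real_normed_vector \<Rightarrow>\<^sub>L 'a) \<Rightarrow> ('a \<Rightarrow>\<^sub>L 'a) \<Rightarrow> ('a \<Rightarrow>\<^sub>L 'a) \<Rightarrow> ('a \<Rightarrow>\<^sub>L 'a)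
    \<Rightarrow> ('a \<times> 'a) \<Rightarrow>\<^sub>L ('a \<times> 'a)"
  is "\<lambda>P Q R S p. (P (fst p) + Q (snd p), R (fst p) + S (snd p))"
  by (intro bounded_linear_Pair bounded_linear_add;
      rule bounded_linear_compose, assumption, rule bounded_linear_fst bounded_linear_snd)

definition csubspace :: "'a::complex_vector set \<Rightarrow> bool"
  where "csubspace S \<longleftrightarrow>
    0 \<in> S \<and> (\<forall>x\<in>S. \<forall>y\<in>S. x + y \<in> S) \<and> (\<forall>c. \<forall>x\<in>S. c *\<^sub>C x \<in> S)"

text \<open>
  Below, \<open>E\<close> is meant to be a closed subspace of the ambient Banach space; so a subset of \<open>E\<close>
  is closed in \<open>E\<close> iff it is closed.
\<close>
definition real_complemented_in :: "'a::real_normed_vector set \<Rightarrow> 'a set \<Rightarrow> bool"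
  where "real_complemented_in E M \<longleftrightarrow>
    M \<subseteq> E \<and> closed M \<and> subspace M \<and>
    (\<exists>N. N \<subseteq> E \<and> closed N \<and> subspace N \<and>
         M \<inter> N = {0} \<and> {m + n | m n. m \<in> M \<and> n \<in> N} = E)"

definition complex_complemented_in :: "'a::complex_normed_vector set \<Rightarrow> 'a set \<Rightarrow> bool"
  where "complex_complemented_in E M \<longleftrightarrow>
    M \<subseteq> E \<and> closed M \<and> csubspace M \<and>
    (\<exists>N. N \<subseteq> E \<and> closed N \<and> csubspace N \<and>
         M \<inter> N = {0} \<and> {m + n | m n. m \<in> M \<and> n \<in> N} = E)"

end

theory Submission imports Defs begin

text \<open>
  Write a bounded operator on \<open>H \<times> H\<close> as a matrix with rows \<open>P, Q\<close> and \<open>R, S\<close>.  Since \<open>A\<close> is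
  injective, this operator commutes with the one whose only nonzero entry is \<open>A\<close>, in the upper right
  corner, iff \<open>R = 0\<close> and \<open>P A = A S\<close>; the entry \<open>Q\<close> is arbitrary.  As \<open>A\<close> is self-adjoint, the second
  condition is invariant under the conjugate-linear involution sending \<open>(P, S)\<close> to
  \<open>(S\<^sup>*, P\<^sup>*)\<close>.  The fixed points of this involution are the pairs \<open>(X\<^sup>*, X)\<close>, and such a pair
  satisfies the condition iff \<open>X\<close> is \<open>A\<close>-symmetric.  So, up to the summand of the matrices \<open>Q\<close>, the
  commutant is the complexification of the real space of \<open>A\<close>-symmetric operators, in the same way as
  the space of all diagonal matrices is the complexification of the real space of all operators on
  \<open>H\<close>.  The lemma \<open>commutant_iff_hermitian_parts\<close> expresses this through the map
  \<open>U B = (S + P\<^sup>*) / 2\<close>, which computes the fixed part of a matrix \<open>B\<close>: the matrix lies in the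
  commutant iff \<open>R = 0\<close> and both \<open>U B\<close> and \<open>U (\<i> B)\<close> are \<open>A\<close>-symmetric.

  Given a real complement \<open>N\<close> of the \<open>A\<close>-symmetric operators, its complexification, namely the matrices
  with \<open>Q = 0\<close> for which \<open>U B\<close> and \<open>U (\<i> B)\<close> are in \<open>N\<close>, is a complex complement of the commutant.

  Conversely, let \<open>\<Pi>\<close> be the projection onto the commutant along a complement.  If \<open>W X\<close> is the
  diagonal matrix of \<open>(X\<^sup>*, X)\<close>, then \<open>U \<circ> \<Pi> \<circ> W\<close> maps into the \<open>A\<close>-symmetric operators and fixes each
  of them.  Its kernel is a complement, and is closed because \<open>\<Pi>\<close> is bounded.  That boundedness is the
  one place where completeness of the operator space enters (\<open>direct_sum_projection_bound\<close>), by the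
  argument of the open mapping theorem.
\<close>

section \<open>Adjoints of bounded operators\<close>

text \<open>
  The representing vector is the minimiser of \<open>\<parallel>x\<parallel>\<^sup>2 - 2 f x\<close>, whose derivative at \<open>x\<close> in direction \<open>y\<close>
  is \<open>2 (x \<bullet> y - f y)\<close>.  It exists because the parallelogram law makes minimising sequences Cauchy.
\<close>
lemma riesz_representation:
  fixes f :: "'a::{real_inner,complete_space} \<Rightarrow> real"
  assumes "bounded_linear f"
  shows "\<exists>z. \<forall>y. f y = z \<bullet> y"
proof -
  interpret f: bounded_linear f by fact
  define g where "g x = (norm x)\<^sup>2 - 2 * f x" for x
  have parallelogram: "(norm (x - y))\<^sup>2 = 2 * g x + 2 * g y - 4 * g ((1/2) *\<^sub>R (x + y))" for x y
    unfolding g_def power2_norm_eq_inner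
    by (simp add: f.scaleR f.add inner_add_left inner_add_right inner_diff_left inner_diff_right
        inner_commute field_simps)
  obtain K where K: "\<And>x. \<bar>f x\<bar> \<le> norm x * K"
    using f.bounded by auto
  have "- K\<^sup>2 \<le> g x" for x
  proof -
    have "0 \<le> (norm x - K)\<^sup>2" by simp
    then show ?thesis
      using K[of x] unfolding g_def by (simp add: power2_diff algebra_simps abs_le_iff)
  qed
  then have bdd: "bdd_below (range g)"
    by (intro bdd_belowI2[of _ "- K\<^sup>2"])
  define d where "d = (INF x. g x)"
  have d_le: "d \<le> g x" for x
    unfolding d_def by (rule cINF_lower[OF bdd]) simp
  have "\<exists>x. g x < d + inverse (real (Suc n))" for n
    using cINF_less_iff[OF _ bdd, of "d + inverse (real (Suc n))"] by (simp add: d_def)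
  then obtain x where x: "\<And>n. g (x n) < d + inverse (real (Suc n))"
    by metis
  have dist: "(norm (x m - x n))\<^sup>2 \<le> 2 * inverse (real (Suc m)) + 2 * inverse (real (Suc n))" for m n
    using parallelogram[of "x m" "x n"] x[of m] x[of n] d_le[of "(1/2) *\<^sub>R (x m + x n)"] by linarith
  have "Cauchy x"
  proof (rule CauchyI)
    fix e :: real assume "0 < e"
    then obtain k where k: "inverse (real (Suc k)) < e\<^sup>2 / 4"
      using reals_Archimedean[of "e\<^sup>2 / 4"] by auto
    have "norm (x m - x n) < e" if "k \<le> m" "k \<le> n" for m n
    proof -
      have "inverse (real (Suc m)) \<le> inverse (real (Suc k))" "inverse (real (Suc n)) \<le> inverse (real (Suc k))"
        using that by (auto intro!: le_imp_inverse_le)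
      then have "(norm (x m - x n))\<^sup>2 < e\<^sup>2"
        using dist[of m n] k by linarith
      then show ?thesis
        using \<open>0 < e\<close> by (simp add: power_less_imp_less_base)
    qed
    then show "\<exists>M. \<forall>m\<ge>M. \<forall>n\<ge>M. norm (x m - x n) < e" by blast
  qed
  then obtain z where z: "x \<longlonglongrightarrow> z"
    using Cauchy_convergent convergent_def by blast
  have "(\<lambda>n. g (x n)) \<longlonglongrightarrow> g z"
    unfolding g_def by (intro tendsto_intros z f.tendsto)
  moreover have "(\<lambda>n. d + inverse (real (Suc n))) \<longlonglongrightarrow> d + 0"
    by (intro tendsto_intros LIMSEQ_inverse_real_of_nat)
  ultimately have "g z \<le> d + 0"
    by (rule LIMSEQ_le) (use x less_imp_le in blast)
  then have minimal: "g z \<le> g y" for y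
    using d_le[of y] by simp
  have "f y = z \<bullet> y" for y
  proof (rule ccontr)
    assume "f y \<noteq> z \<bullet> y"
    \<comment> \<open>Otherwise a step from \<open>z\<close> along \<open>y\<close>, against the sign of the derivative \<open>2 c\<close>, decreases \<open>g\<close>;
      the step length \<open>s\<close> is small enough for the quadratic term not to compensate.\<close>
    define c where "c = z \<bullet> y - f y"
    define s where "s = inverse ((norm y)\<^sup>2 + 1)"
    have "0 < (norm y)\<^sup>2 + 1" by (simp add: add_nonneg_pos)
    then have s: "0 < s" "s * (norm y)\<^sup>2 \<le> 1"
      by (auto simp: s_def field_simps)
    have "c \<noteq> 0" using \<open>f y \<noteq> z \<bullet> y\<close> by (simp add: c_def)
    have "g (z + (- c * s) *\<^sub>R y) = g z + c\<^sup>2 * s * (s * (norm y)\<^sup>2 - 2)"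
      unfolding g_def power2_norm_eq_inner c_def
      by (simp add: f.add f.diff f.scaleR inner_add_left inner_add_right inner_diff_left inner_diff_right
          inner_commute algebra_simps power2_eq_square)
    moreover have "c\<^sup>2 * s * (s * (norm y)\<^sup>2 - 2) < 0"
      using s \<open>c \<noteq> 0\<close> by (intro mult_pos_neg) auto
    ultimately show False
      using minimal[of "z + (- c * s) *\<^sub>R y"] by linarith
  qed
  then show ?thesis by blast
qed

lemma norm_adjoint_apply_le:
  fixes B :: "'a::{real_inner,complete_space} \<Rightarrow>\<^sub>L 'a"
  assumes "\<And>x y. B x \<bullet> y = x \<bullet> C y"
  shows "norm (C y) \<le> norm B * norm y"
proof -
  have "norm (C y) * norm (C y) = B (C y) \<bullet> y"
    by (simp add: assms power2_norm_eq_inner[symmetric] power2_eq_square)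
  also have "\<dots> \<le> norm (B (C y)) * norm y" by (rule norm_cauchy_schwarz)
  also have "\<dots> \<le> (norm B * norm (C y)) * norm y"
    by (intro mult_right_mono norm_blinfun) simp
  finally have "norm (C y) * norm (C y) \<le> norm (C y) * (norm B * norm y)"
    by (simp add: mult_ac)
  then show ?thesis
    by (cases "C y = 0") auto
qed

text \<open>
  The adjoint with respect to the real inner product.  It is a total bounded real-linear map, which
  agrees with \<^const>\<open>cadjoint\<close> on complex-linear operators.
\<close>
definition blinfun_adjoint ::
    "('a::{real_inner,complete_space} \<Rightarrow>\<^sub>L 'a) \<Rightarrow> 'a \<Rightarrow>\<^sub>L 'a"
  where "blinfun_adjoint B = (SOME C. \<forall>x y. B x \<bullet> y = x \<bullet> blinfun_apply C y)"

lemma inner_blinfun_adjoint: "B x \<bullet> y = x \<bullet> blinfun_adjoint B y"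
  for B :: "'a::{real_inner,complete_space} \<Rightarrow>\<^sub>L 'a"
proof -
  have "\<exists>z. \<forall>x. B x \<bullet> y = z \<bullet> x" for y
    by (rule riesz_representation)
      (rule bounded_linear_compose[OF bounded_linear_inner_left blinfun.bounded_linear_right])
  then obtain C where "\<And>x y. B x \<bullet> y = C y \<bullet> x" by metis
  then have C: "\<And>x y. B x \<bullet> y = x \<bullet> C y" by (simp add: inner_commute)
  have "bounded_linear C"
  proof (rule bounded_linear_intro[where K = "norm B"])
    show "C (x + y) = C x + C y" for x y
      by (rule vector_eq_rdot[THEN iffD1]) (simp add: C[symmetric] inner_add_right inner_commute[of "C _"] inner_add_left)
    show "C (r *\<^sub>R x) = r *\<^sub>R C x" for r x
      by (rule vector_eq_rdot[THEN iffD1]) (simp add: C[symmetric] inner_commute[of "C _"])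
    show "norm (C x) \<le> norm x * norm B" for x
      using norm_adjoint_apply_le[of B C x] C by (simp add: mult.commute)
  qed
  then have "\<forall>x y. B x \<bullet> y = x \<bullet> blinfun_apply (Blinfun C) y"
    by (simp add: bounded_linear_Blinfun_apply C)
  then have "\<forall>x y. B x \<bullet> y = x \<bullet> blinfun_apply (blinfun_adjoint B) y"
    unfolding blinfun_adjoint_def by (rule someI)
  then show ?thesis by blast
qed

lemma blinfun_adjoint_eqI:
  fixes B :: "'a::{real_inner,complete_space} \<Rightarrow>\<^sub>L 'a"
  assumes "\<And>x y. B x \<bullet> y = x \<bullet> blinfun_apply C y"
  shows "blinfun_adjoint B = C"
  by (rule blinfun_eqI, rule vector_eq_ldot[THEN iffD1])
    (metis assms inner_blinfun_adjoint)

lemma blinfun_adjoint_adjoint [simp]: "blinfun_adjoint (blinfun_adjoint B) = B"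
  by (rule blinfun_adjoint_eqI) (metis inner_blinfun_adjoint inner_commute)

lemma blinfun_adjoint_compose:
  "blinfun_adjoint (B o\<^sub>L C) = blinfun_adjoint C o\<^sub>L blinfun_adjoint B"
  by (rule blinfun_adjoint_eqI) (simp add: inner_blinfun_adjoint)

lemma norm_blinfun_adjoint_le: "norm (blinfun_adjoint B) \<le> norm B"
  by (intro norm_blinfun_bound norm_adjoint_apply_le inner_blinfun_adjoint norm_ge_zero)

lemma bounded_linear_blinfun_adjoint: "bounded_linear blinfun_adjoint"
proof (rule bounded_linear_intro[where K = 1])
  show "blinfun_adjoint (x + y) = blinfun_adjoint x + blinfun_adjoint y" for x y :: "'a \<Rightarrow>\<^sub>L 'a"
    by (rule blinfun_adjoint_eqI)
      (simp add: blinfun.add_left inner_add_left inner_add_right inner_blinfun_adjoint)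
  show "blinfun_adjoint (r *\<^sub>R x) = r *\<^sub>R blinfun_adjoint x" for r and x :: "'a \<Rightarrow>\<^sub>L 'a"
    by (rule blinfun_adjoint_eqI) (simp add: blinfun.scaleR_left inner_blinfun_adjoint)
qed (simp add: norm_blinfun_adjoint_le)

lemmas blinfun_adjoint_add = linear_add[OF bounded_linear.linear[OF bounded_linear_blinfun_adjoint]]
lemmas blinfun_adjoint_scaleR = linear_scale[OF bounded_linear.linear[OF bounded_linear_blinfun_adjoint]]
lemmas blinfun_adjoint_zero = linear_0[OF bounded_linear.linear[OF bounded_linear_blinfun_adjoint]]

section \<open>Complex scalars and complex-linear operators\<close>

lemma bounded_linear_scaleC: "bounded_linear (\<lambda>x::'a::complex_normed_vector. c *\<^sub>C x)"
  by (rule bounded_linear_intro[where K = "cmod c"])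
    (simp_all add: scaleC_add_right scaleR_scaleC scaleC_scaleC norm_scaleC mult.commute)

lemma scaleC_simps [simp]:
  fixes x :: "'a::complex_normed_vector"
  shows "c *\<^sub>C (0::'a) = 0" "c *\<^sub>C (- x) = - (c *\<^sub>C x)" "c *\<^sub>C (r *\<^sub>R x) = r *\<^sub>R (c *\<^sub>C x)"
    "(- c) *\<^sub>C x = - (c *\<^sub>C x)"
proof -
  interpret s: bounded_linear "\<lambda>x::'a. c *\<^sub>C x" by (rule bounded_linear_scaleC)
  show "c *\<^sub>C (0::'a) = 0" by (rule s.zero)
  show minus: "c *\<^sub>C (- x) = - (c *\<^sub>C x)" by (rule s.neg)
  show "c *\<^sub>C (r *\<^sub>R x) = r *\<^sub>R (c *\<^sub>C x)" by (rule s.scaleR)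
  show "(- c) *\<^sub>C x = - (c *\<^sub>C x)"
    using scaleR_scaleC[of "-1" x] by (simp add: scaleC_scaleC minus[symmetric])
qed

lemma scaleC_diff_right: "c *\<^sub>C (x - y) = c *\<^sub>C x - c *\<^sub>C y"
  for x y :: "'a::complex_normed_vector"
  using scaleC_add_right[of c x "- y"] by simp

lemma scaleC_Re_Im: "c *\<^sub>C x = Re c *\<^sub>R x + Im c *\<^sub>R (\<i> *\<^sub>C x)"
  for x :: "'a::complex_vector"
  using complex_eq[of c]
  by (metis scaleC_add_left scaleC_scaleC scaleR_scaleC mult.commute)

lemma scaleC_ii_ii [simp]: "\<i> *\<^sub>C \<i> *\<^sub>C x = - x"
  for x :: "'a::complex_vector"
  using scaleR_scaleC[of "-1" x] by (simp add: scaleC_scaleC)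

lemma inner_scaleC_left: "(c *\<^sub>C x) \<bullet> y = x \<bullet> (cnj c *\<^sub>C y)"
  for x y :: "'a::complex_inner"
  by (simp add: inner_eq_Re_cinner cinner_scaleC_left cinner_scaleC_right)

lemma subspace_if_csubspace: "csubspace S \<Longrightarrow> subspace S"
  unfolding csubspace_def subspace_def by (simp add: scaleR_scaleC)

lemma real_complemented_if_complex_complemented_in:
  assumes "complex_complemented_in E M"
  shows "real_complemented_in E M"
proof -
  obtain N where "N \<subseteq> E" "closed N" "csubspace N" "M \<inter> N = {0}" "{m + n | m n. m \<in> M \<and> n \<in> N} = E"
    and "M \<subseteq> E" "closed M" "csubspace M"
    using assms unfolding complex_complemented_in_def by (elim conjE exE)
  then show ?thesis
    unfolding real_complemented_in_def by (intro conjI exI[of _ N] subspace_if_csubspace)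
qed

lemma csubspaceI:
  fixes S :: "'a::complex_vector set"
  assumes "subspace S" "\<And>x. x \<in> S \<Longrightarrow> \<i> *\<^sub>C x \<in> S"
  shows "csubspace S"
proof -
  have "c *\<^sub>C x \<in> S" if "x \<in> S" for c x
    unfolding scaleC_Re_Im[of c x] using assms that by (intro subspace_add subspace_mul)
  then show ?thesis
    using assms(1) by (auto simp: csubspace_def subspace_0 subspace_add)
qed

lemma cbounded_opsD: "B \<in> cbounded_ops \<Longrightarrow> B (c *\<^sub>C x) = c *\<^sub>C B x"
  by (simp add: cbounded_ops_def)

lemma csubspace_cbounded_ops: "csubspace (cbounded_ops :: ('a::complex_normed_vector \<Rightarrow>\<^sub>L 'a) set)"
proof -
  interpret s: bounded_linear "\<lambda>x::'a. c *\<^sub>C x" for c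
    by (rule bounded_linear_scaleC)
  show ?thesis
    unfolding csubspace_def cbounded_ops_def
    by (simp add: blinfun.add_left scaleC_blinfun.rep_eq scaleC_add_right scaleC_scaleC mult.commute s.zero)
qed

lemmas subspace_cbounded_ops = subspace_if_csubspace[OF csubspace_cbounded_ops]

lemma scaleC_cbounded_ops: "B \<in> cbounded_ops \<Longrightarrow> c *\<^sub>C B \<in> cbounded_ops"
  by (metis csubspace_cbounded_ops csubspace_def)

lemma blinfun_adjoint_cbounded_ops:
  fixes B :: "'a::chilbert_space \<Rightarrow>\<^sub>L 'a"
  assumes "B \<in> cbounded_ops"
  shows "blinfun_adjoint B \<in> cbounded_ops"
proof -
  have "blinfun_adjoint B (c *\<^sub>C y) = c *\<^sub>C blinfun_adjoint B y" for c y
  proof (rule vector_eq_ldot[THEN iffD1], rule allI)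
    fix x
    have "x \<bullet> blinfun_adjoint B (c *\<^sub>C y) = B (cnj c *\<^sub>C x) \<bullet> y"
      using inner_scaleC_left[of "cnj c" "B x" y]
      by (simp add: inner_blinfun_adjoint[symmetric] cbounded_opsD[OF assms])
    also have "\<dots> = x \<bullet> (c *\<^sub>C blinfun_adjoint B y)"
      by (simp add: inner_blinfun_adjoint inner_scaleC_left)
    finally show "x \<bullet> blinfun_adjoint B (c *\<^sub>C y) = x \<bullet> (c *\<^sub>C blinfun_adjoint B y)" .
  qed
  then show ?thesis by (simp add: cbounded_ops_def)
qed

lemma blinfun_adjoint_scaleC:
  fixes B :: "'a::chilbert_space \<Rightarrow>\<^sub>L 'a"
  assumes "B \<in> cbounded_ops"
  shows "blinfun_adjoint (c *\<^sub>C B) = cnj c *\<^sub>C blinfun_adjoint B"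
  by (rule blinfun_adjoint_eqI)
    (simp add: scaleC_blinfun.rep_eq inner_scaleC_left inner_blinfun_adjoint
      cbounded_opsD[OF blinfun_adjoint_cbounded_ops[OF assms]])

lemma cinner_eqI_Re:
  fixes x y :: "'a::complex_inner"
  assumes "\<And>c. (c *\<^sub>C x) \<bullet> y = (c *\<^sub>C x') \<bullet> y'"
  shows "cinner x y = cinner x' y'"
  using assms[of 1] assms[of "\<i>"]
  by (intro complex_eqI) (simp_all add: inner_eq_Re_cinner cinner_scaleC_left)

text \<open>
  A complex inner product is determined by its real part, applied to all complex multiples of one
  argument; so the real adjoint of a complex-linear operator is its complex adjoint.
\<close>
lemma cadjoint_eq_blinfun_adjoint:
  fixes B :: "'a::chilbert_space \<Rightarrow>\<^sub>L 'a"
  assumes "B \<in> cbounded_ops"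
  shows "cadjoint B = blinfun_adjoint B"
  by (rule cadjoint_eqI, rule cinner_eqI_Re)
    (metis assms cbounded_opsD inner_blinfun_adjoint)

text \<open>Polarization: on a complex space, an operator with a real quadratic form is self-adjoint.\<close>
lemma blinfun_adjoint_eq_if_op_le:
  fixes A :: "'a::chilbert_space \<Rightarrow>\<^sub>L 'a"
  assumes "A \<in> cbounded_ops" "op_le 0 A"
  shows "blinfun_adjoint A = A"
proof (rule blinfun_adjoint_eqI)
  have real: "Im (cinner (A x) x) = 0" for x
    using assms(2) by (simp add: op_le_def complex_is_Real_iff)
  have swap: "Im (cinner (A x) y) = - Im (cinner (A y) x)" for x y
  proof -
    have "cinner u (v + w) = cinner u v + cinner u w" for u v w :: 'a
      by (metis cinner_add_left cinner_commute complex_cnj_add)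
    then show ?thesis
      using real[of "x + y"] real[of x] real[of y]
      by (simp add: blinfun.add_right cinner_add_left)
  qed
  fix x y
  have "A x \<bullet> y = Im (cinner (A (\<i> *\<^sub>C x)) y)"
    by (simp add: cbounded_opsD[OF assms(1)] cinner_scaleC_left inner_eq_Re_cinner)
  also have "\<dots> = - Im (cinner (A y) (\<i> *\<^sub>C x))" by (rule swap)
  also have "\<dots> = A y \<bullet> x"
    by (simp add: cinner_scaleC_right inner_eq_Re_cinner)
  finally show "A x \<bullet> y = x \<bullet> A y" by (simp add: inner_commute)
qed

section \<open>Bounded projections\<close>

text \<open>
  By Baire's theorem, one of the sets \<open>S k\<close> of sums whose first summand has norm at most \<open>k\<close> is dense
  in a relatively open subset of the sum; hence differences of its elements approximate every element
  of the sum in a neighbourhood of \<open>0\<close>.  After scaling, each \<open>z\<close> in the sum is approximated with error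
  \<open>\<parallel>z\<parallel> / 2\<close> by a sum whose first summand is bounded by \<open>C \<parallel>z\<parallel>\<close>.  Iterating on the errors produces a
  convergent series of first summands, whose limit must be the component of \<open>z\<close> in \<open>M\<close>.  The second
  summands converge too, being determined by \<open>z\<close>, the first summands and the error.
\<close>
lemma direct_sum_projection_bound:
  fixes M N :: "'a::banach set"
  assumes "closed M" "subspace M" "closed N" "subspace N" "M \<inter> N = {0}"
    and closed_sum: "closed {m + n | m n. m \<in> M \<and> n \<in> N}"
  obtains K where "\<And>m n. m \<in> M \<Longrightarrow> n \<in> N \<Longrightarrow> norm m \<le> K * norm (m + n)"
proof -
  define E where "E = {m + n | m n. m \<in> M \<and> n \<in> N}"
  have "closed E" using closed_sum by (simp add: E_def)
  have "subspace E"
    unfolding E_def using subspace_sums[OF \<open>subspace M\<close> \<open>subspace N\<close>] by simp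
  have M_E: "m \<in> E" if "m \<in> M" for m
    using that subspace_0[OF \<open>subspace N\<close>] unfolding E_def by force
  have N_E: "n \<in> E" if "n \<in> N" for n
    using that subspace_0[OF \<open>subspace M\<close>] unfolding E_def by force
  define S where "S k = {m + n | m n. m \<in> M \<and> n \<in> N \<and> norm m \<le> real k}" for k :: nat
  have S_E: "closure (S k) \<subseteq> E" for k
    by (rule closure_minimal) (use \<open>closed E\<close> in \<open>auto simp: S_def E_def\<close>)
  have "E \<subseteq> (\<Union>k. S k)"
  proof
    fix z assume "z \<in> E"
    then obtain m n where mn: "m \<in> M" "n \<in> N" "z = m + n" by (auto simp: E_def)
    obtain k where "norm m \<le> real k" using real_arch_simple by blast
    with mn show "z \<in> (\<Union>k. S k)" by (auto simp: S_def)
  qed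
  moreover have "(\<Union>k. S k) \<subseteq> (\<Union>k. closure (S k))"
    by (intro UN_mono order_refl closure_subset)
  moreover have "(\<Union>k. closure (S k)) \<subseteq> E"
    by (rule UN_least) (rule S_E)
  ultimately have E_Union: "(\<Union>k. closure (S k)) = E"
    by blast
  obtain k x\<^sub>0 where x\<^sub>0: "x\<^sub>0 \<in> top_of_set E interior_of closure (S k)"
  proof -
    have "completely_metrizable_space (top_of_set E)"
      using \<open>closed E\<close> by (intro completely_metrizable_space_closedin completely_metrizable_space_euclidean) simp
    moreover have "closedin (top_of_set E) (closure (S k))" for k
      using S_E by (intro closed_subset) auto
    moreover have "top_of_set E interior_of E = E"
      by (metis interior_of_topspace topspace_euclidean_subtopology)
    moreover have "E \<noteq> {}" using subspace_0[OF \<open>subspace E\<close>] by blast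
    ultimately have "\<exists>k. top_of_set E interior_of closure (S k) \<noteq> {}"
      using Baire_category_alt[of "top_of_set E" "range (\<lambda>k. closure (S k))"] E_Union by auto
    then show thesis using that by blast
  qed
  then obtain r where "0 < r" and r: "\<And>z. z \<in> E \<Longrightarrow> dist x\<^sub>0 z < r \<Longrightarrow> z \<in> closure (S k)" and "x\<^sub>0 \<in> E"
  proof -
    obtain T where "openin (top_of_set E) T" "x\<^sub>0 \<in> T" "T \<subseteq> closure (S k)"
      using x\<^sub>0 by (auto simp: interior_of_def)
    then show thesis
      using that unfolding openin_euclidean_subtopology_iff by (metis dist_commute subsetD)
  qed
  define C where "C = 4 * real k / r"
  have small: "\<exists>m\<in>M. \<exists>n\<in>N. norm m \<le> 2 * real k \<and> norm (z - m - n) < e"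
    if "z \<in> E" "norm z < r" "0 < e" for z e
  proof -
    have "x\<^sub>0 + z \<in> closure (S k)"
      using that \<open>x\<^sub>0 \<in> E\<close> \<open>subspace E\<close> by (intro r) (auto simp: subspace_add dist_norm)
    then obtain p where p: "p \<in> S k" "dist p (x\<^sub>0 + z) < e/2"
      using \<open>0 < e\<close> by (meson closure_approachable half_gt_zero)
    have "x\<^sub>0 \<in> closure (S k)"
      using \<open>x\<^sub>0 \<in> E\<close> \<open>0 < r\<close> by (intro r) auto
    then obtain q where q: "q \<in> S k" "dist q x\<^sub>0 < e/2"
      using \<open>0 < e\<close> by (meson closure_approachable half_gt_zero)
    obtain m n where mn: "m \<in> M" "n \<in> N" "norm m \<le> real k" "p = m + n"
      using p(1) by (auto simp: S_def)
    obtain m' n' where mn': "m' \<in> M" "n' \<in> N" "norm m' \<le> real k" "q = m' + n'"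
      using q(1) by (auto simp: S_def)
    have "norm (m - m') \<le> 2 * real k"
      using norm_triangle_ineq4[of m m'] mn(3) mn'(3) by linarith
    moreover have "norm (z - (m - m') - (n - n')) < e"
    proof -
      have "z - (m - m') - (n - n') = (x\<^sub>0 + z - p) - (x\<^sub>0 - q)"
        by (simp add: mn(4) mn'(4))
      then have "norm (z - (m - m') - (n - n')) \<le> norm (x\<^sub>0 + z - p) + norm (x\<^sub>0 - q)"
        by (metis norm_triangle_ineq4)
      also have "\<dots> < e/2 + e/2"
        using p(2) q(2) by (intro add_strict_mono) (simp_all add: dist_norm norm_minus_commute)
      finally show ?thesis by simp
    qed
    ultimately show ?thesis
      using mn mn' \<open>subspace M\<close> \<open>subspace N\<close> by (meson subspace_diff)
  qed
  \<comment> \<open>Rescale \<open>z\<close> to norm \<open>r / 2\<close> and take \<open>e = r / 4\<close>.\<close>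
  have halve: "\<exists>m\<in>M. \<exists>n\<in>N. norm m \<le> C * norm z \<and> norm (z - m - n) \<le> norm z / 2"
    if "z \<in> E" for z
  proof (cases "z = 0")
    case True
    then show ?thesis
      using subspace_0[OF \<open>subspace M\<close>] subspace_0[OF \<open>subspace N\<close>] by force
  next
    case False
    define t where "t = r / (2 * norm z)"
    have "0 < t" using False \<open>0 < r\<close> by (simp add: t_def)
    have tz: "norm (t *\<^sub>R z) = r / 2" using False \<open>0 < r\<close> by (simp add: t_def)
    obtain m n where mn: "m \<in> M" "n \<in> N" "norm m \<le> 2 * real k" "norm (t *\<^sub>R z - m - n) < r / 4"
    proof -
      have "t *\<^sub>R z \<in> E" using \<open>subspace E\<close> \<open>z \<in> E\<close> by (rule subspace_mul)
      moreover have "norm (t *\<^sub>R z) < r" unfolding tz using \<open>0 < r\<close> by simp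
      moreover have "0 < r / 4" using \<open>0 < r\<close> by simp
      ultimately show thesis using that small by blast
    qed
    have "norm (inverse t *\<^sub>R m) = inverse t * norm m"
      using \<open>0 < t\<close> by simp
    also have "\<dots> \<le> inverse t * (2 * real k)"
      using \<open>0 < t\<close> mn(3) by (intro mult_left_mono) auto
    also have "\<dots> = C * norm z"
      by (simp add: t_def C_def)
    finally have 1: "norm (inverse t *\<^sub>R m) \<le> C * norm z" .
    have "z - inverse t *\<^sub>R m - inverse t *\<^sub>R n = inverse t *\<^sub>R (t *\<^sub>R z - m - n)"
      using \<open>0 < t\<close> by (simp add: algebra_simps)
    then have "norm (z - inverse t *\<^sub>R m - inverse t *\<^sub>R n) = inverse t * norm (t *\<^sub>R z - m - n)"
      using \<open>0 < t\<close> by simp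
    also have "\<dots> \<le> inverse t * (r / 4)"
      using \<open>0 < t\<close> mn(4) by (intro mult_left_mono) auto
    also have "\<dots> = norm z / 2"
      using \<open>0 < r\<close> by (simp add: t_def)
    finally show ?thesis
      using 1 mn \<open>subspace M\<close> \<open>subspace N\<close> by (meson subspace_mul)
  qed
  then obtain f g where fg: "\<And>z. z \<in> E \<Longrightarrow> f z \<in> M" "\<And>z. z \<in> E \<Longrightarrow> g z \<in> N"
      "\<And>z. z \<in> E \<Longrightarrow> norm (f z) \<le> C * norm z"
      "\<And>z. z \<in> E \<Longrightarrow> norm (z - f z - g z) \<le> norm z / 2"
    by metis
  have "norm m \<le> 2 * C * norm (m + n)" if "m \<in> M" "n \<in> N" for m n
  proof -
    define z where "z = m + n"
    \<comment> \<open>\<open>h j\<close> is the error that remains after \<open>j\<close> approximation steps.\<close>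
    define h where "h j = ((\<lambda>z. z - f z - g z) ^^ j) z" for j
    have h_Suc: "h (Suc j) = h j - f (h j) - g (h j)" for j
      by (simp add: h_def)
    have h_E: "h j \<in> E" for j
    proof (induction j)
      case 0
      show ?case using that by (auto simp: h_def z_def E_def)
    next
      case (Suc j)
      then show ?case
        unfolding h_Suc using fg(1,2)[OF Suc] \<open>subspace E\<close> M_E N_E by (meson subspace_diff)
    qed
    have norm_h: "norm (h j) \<le> norm z * (1/2)^j" for j
    proof (induction j)
      case (Suc j)
      then show ?case unfolding h_Suc using fg(4)[OF h_E, of j] by simp
    qed (simp add: h_def)
    have "0 \<le> C" using \<open>0 < r\<close> by (simp add: C_def)
    have norm_f: "norm (f (h j)) \<le> C * norm z * (1/2)^j" for j
      using fg(3)[OF h_E, of j] mult_left_mono[OF norm_h \<open>0 \<le> C\<close>, of j] by simp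
    have sums: "(\<lambda>j. C * norm z * (1/2)^j) sums (C * norm z * 2)"
      using sums_mult[OF geometric_sums[of "1/2::real"], of "C * norm z"] by simp
    have summable: "summable (\<lambda>j. norm (f (h j)))"
      by (rule summable_comparison_test'[OF sums_summable[OF sums]]) (use norm_f in auto)
    define m' where "m' = (\<Sum>j. f (h j))"
    have partial: "(\<lambda>j. \<Sum>i<j. f (h i)) \<longlonglongrightarrow> m'"
      unfolding m'_def by (rule summable_LIMSEQ[OF summable_norm_cancel[OF summable]])
    have "m' \<in> M"
      by (rule closed_sequentially[OF \<open>closed M\<close> _ partial])
        (intro allI subspace_sum \<open>subspace M\<close> fg(1) h_E)
    have "norm m' \<le> (\<Sum>j. norm (f (h j)))"
      unfolding m'_def by (rule summable_norm[OF summable])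
    also have "\<dots> \<le> C * norm z * 2"
      using suminf_le[OF norm_f summable sums_summable[OF sums]] sums_unique[OF sums] by simp
    finally have norm_m': "norm m' \<le> 2 * C * norm z" by simp
    have telescope: "(\<Sum>i<j. g (h i)) = z - h j - (\<Sum>i<j. f (h i))" for j
    proof (induction j)
      case (Suc j)
      then show ?case by (simp add: h_Suc)
    qed (simp add: h_def)
    have "h \<longlonglongrightarrow> 0"
    proof (rule Lim_null_comparison)
      show "\<forall>\<^sub>F j in sequentially. norm (h j) \<le> norm z * (1/2)^j" using norm_h by simp
      show "(\<lambda>j. norm z * (1/2)^j) \<longlonglongrightarrow> 0"
        by (intro tendsto_mult_right_zero LIMSEQ_power_zero) simp
    qed
    then have "(\<lambda>j. \<Sum>i<j. g (h i)) \<longlonglongrightarrow> z - 0 - m'"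
      unfolding telescope by (intro tendsto_intros partial)
    then have "z - 0 - m' \<in> N"
      by (rule closed_sequentially[OF \<open>closed N\<close>, rotated])
        (intro allI subspace_sum \<open>subspace N\<close> fg(2) h_E)
    then have "(z - 0 - m') - n \<in> N"
      using \<open>n \<in> N\<close> by (rule subspace_diff[OF \<open>subspace N\<close>])
    moreover have "(z - 0 - m') - n = m - m'" by (simp add: z_def)
    ultimately have "m - m' \<in> N" by (simp only:)
    moreover have "m - m' \<in> M"
      using \<open>m \<in> M\<close> \<open>m' \<in> M\<close> by (rule subspace_diff[OF \<open>subspace M\<close>])
    ultimately have "m - m' \<in> {0}" using \<open>M \<inter> N = {0}\<close> by blast
    then have "m = m'" by simp
    then show ?thesis using norm_m' by (simp add: z_def)
  qed
  then show thesis by (rule that)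
qed

text \<open>
  If \<open>\<Pi>\<close> is the projection of \<open>F\<close> onto \<open>M'\<close>, then \<open>U \<circ> \<Pi> \<circ> W\<close> is a bounded projection of \<open>E\<close> onto \<open>M\<close>.
  The complement \<open>N\<close> is its kernel; the witness \<open>m\<close> in the definition of \<open>N\<close> is \<open>\<Pi> (W x)\<close>.
\<close>
lemma real_complemented_in_retract:
  fixes U :: "'f::banach \<Rightarrow> 'e::real_normed_vector" and W :: "'e \<Rightarrow> 'f"
  assumes "bounded_linear U" "bounded_linear W"
    and "real_complemented_in F M'" "closed F"
    and "closed E" "subspace E" "M \<subseteq> E" "closed M" "subspace M"
    and W_E: "\<And>x. x \<in> E \<Longrightarrow> W x \<in> F"
    and W_M: "\<And>x. x \<in> M \<Longrightarrow> W x \<in> M'"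
    and U_M: "\<And>x. x \<in> M' \<Longrightarrow> U x \<in> M"
    and U_W: "\<And>x. x \<in> M \<Longrightarrow> U (W x) = x"
  shows "real_complemented_in E M"
proof -
  interpret U: bounded_linear U by fact
  interpret W: bounded_linear W by fact
  obtain N' where M': "closed M'" "subspace M'"
    and N': "closed N'" "subspace N'" "M' \<inter> N' = {0}"
    and sum: "{m + n | m n. m \<in> M' \<and> n \<in> N'} = F"
    using assms(3) unfolding real_complemented_in_def by blast
  obtain K where K: "\<And>m n. m \<in> M' \<Longrightarrow> n \<in> N' \<Longrightarrow> norm m \<le> K * norm (m + n)"
    using direct_sum_projection_bound[OF M' N'] sum \<open>closed F\<close> by metis
  define N where "N = {x \<in> E. \<exists>m\<in>M'. W x - m \<in> N' \<and> U m = 0}"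
  have "closed N"
    unfolding closed_sequential_limits
  proof (intro allI impI, elim conjE)
    fix x l assume x: "\<forall>i. x i \<in> N" and l: "x \<longlonglongrightarrow> l"
    have "l \<in> E" using x by (intro closed_sequentially[OF \<open>closed E\<close> _ l]) (auto simp: N_def)
    obtain m where m: "\<And>i. m i \<in> M'" "\<And>i. W (x i) - m i \<in> N'" "\<And>i. U (m i) = 0"
      using x unfolding N_def by simp metis
    \<comment> \<open>The bound on the projection makes the witnesses converge along with \<open>x\<close>.\<close>
    have lipschitz: "norm (m i - m j) \<le> K * norm (W (x i) - W (x j))" for i j
    proof -
      have "m i - m j \<in> M'" "(W (x i) - m i) - (W (x j) - m j) \<in> N'"
        using m M' N' by (meson subspace_diff)+
      from K[OF this] show ?thesis by simp
    qed
    have W_l: "(\<lambda>i. W (x i)) \<longlonglongrightarrow> W l" by (rule W.tendsto[OF l])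
    have "Cauchy m"
    proof (rule CauchyI)
      fix e :: real assume "0 < e"
      have "Cauchy (\<lambda>i. W (x i))" by (rule LIMSEQ_imp_Cauchy[OF W_l])
      then obtain k where k: "\<And>i j. i \<ge> k \<Longrightarrow> j \<ge> k \<Longrightarrow> norm (W (x i) - W (x j)) < e / (\<bar>K\<bar> + 1)"
        using CauchyD[of "\<lambda>i. W (x i)" "e / (\<bar>K\<bar> + 1)"] \<open>0 < e\<close> by (auto simp: add_nonneg_pos)
      have "norm (m i - m j) < e" if "i \<ge> k" "j \<ge> k" for i j
      proof -
        have "norm (m i - m j) \<le> (\<bar>K\<bar> + 1) * norm (W (x i) - W (x j))"
          by (rule order_trans[OF lipschitz]) (intro mult_right_mono, auto)
        also have "\<dots> < e"
          using k[OF that] by (simp add: field_simps add_nonneg_pos)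
        finally show ?thesis .
      qed
      then show "\<exists>k. \<forall>i\<ge>k. \<forall>j\<ge>k. norm (m i - m j) < e" by blast
    qed
    then obtain m\<^sub>0 where m\<^sub>0: "m \<longlonglongrightarrow> m\<^sub>0"
      using Cauchy_convergent convergent_def by blast
    have "m\<^sub>0 \<in> M'" using m by (intro closed_sequentially[OF M'(1) _ m\<^sub>0]) auto
    moreover have "W l - m\<^sub>0 \<in> N'"
      by (rule closed_sequentially[OF N'(1) _ tendsto_diff[OF W_l m\<^sub>0]]) (use m in auto)
    moreover have "U m\<^sub>0 = 0"
      using LIMSEQ_unique[OF U.tendsto[OF m\<^sub>0]] m(3) by simp
    ultimately show "l \<in> N" using \<open>l \<in> E\<close> by (auto simp: N_def)
  qed
  moreover have "subspace N"
  proof (rule subspaceI)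
    have NI: "x \<in> N" if "x \<in> E" "m \<in> M'" "n \<in> N'" "U m = 0" "W x = m + n" for x m n
      using that by (auto simp: N_def intro!: bexI[of _ m])
    show "0 \<in> N"
      by (rule NI[of 0 0 0]) (simp_all add: subspace_0 \<open>subspace E\<close> M' N' W.zero U.zero)
    show "x + y \<in> N" if xy: "x \<in> N" "y \<in> N" for x y
    proof -
      obtain m m' where "m \<in> M'" "W x - m \<in> N'" "U m = 0" "m' \<in> M'" "W y - m' \<in> N'" "U m' = 0"
        using xy by (auto simp: N_def)
      then show ?thesis
        using xy \<open>subspace E\<close> M' N'
        by (intro NI[of _ "m + m'" "(W x - m) + (W y - m')"])
          (simp_all only: N_def mem_Collect_eq subspace_add U.add W.add, simp_all)
    qed
    show "c *\<^sub>R x \<in> N" if x: "x \<in> N" for c x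
    proof -
      obtain m where "m \<in> M'" "W x - m \<in> N'" "U m = 0" using x by (auto simp: N_def)
      then show ?thesis
        using x \<open>subspace E\<close> M' N'
        by (intro NI[of _ "c *\<^sub>R m" "c *\<^sub>R (W x - m)"])
          (simp_all only: N_def mem_Collect_eq subspace_mul U.scaleR W.scaleR, simp_all add: scaleR_diff_right)
    qed
  qed
  moreover have "M \<inter> N = {0}"
  proof -
    have "x = 0" if x: "x \<in> M" "x \<in> N" for x
    proof -
      obtain m where m: "m \<in> M'" "W x - m \<in> N'" "U m = 0" using x by (auto simp: N_def)
      have "W x - m \<in> M'" using m W_M[OF x(1)] M'(2) by (simp add: subspace_diff)
      then have "W x - m = 0" using m(2) N'(3) by blast
      then show ?thesis using m(3) U_W[OF x(1)] by simp
    qed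
    then show ?thesis
      using subspace_0[OF \<open>subspace M\<close>] subspace_0[OF \<open>subspace N\<close>] by auto
  qed
  moreover have "{m + n | m n. m \<in> M \<and> n \<in> N} = E"
  proof
    show "{m + n | m n. m \<in> M \<and> n \<in> N} \<subseteq> E"
      using \<open>M \<subseteq> E\<close> \<open>subspace E\<close> by (auto simp: N_def intro!: subspace_add)
    show "E \<subseteq> {m + n | m n. m \<in> M \<and> n \<in> N}"
    proof
      fix x assume x: "x \<in> E"
      obtain m n where mn: "m \<in> M'" "n \<in> N'" "W x = m + n"
        using W_E[OF x] sum by auto
      define y where "y = U m"
      have y: "y \<in> M" unfolding y_def by (rule U_M[OF mn(1)])
      have "x - y \<in> E" using x y \<open>M \<subseteq> E\<close> \<open>subspace E\<close> by (auto intro: subspace_diff)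
      moreover have "m - W y \<in> M'" using mn(1) W_M[OF y] M'(2) by (simp add: subspace_diff)
      moreover have "W (x - y) - (m - W y) = n" by (simp add: W.diff mn(3))
      moreover have "U (m - W y) = 0" by (simp add: U.diff U_W[OF y]) (simp add: y_def)
      ultimately have "x - y \<in> N" using mn(2) unfolding N_def by auto
      then show "x \<in> {m + n | m n. m \<in> M \<and> n \<in> N}"
        using y by (intro CollectI exI[of _ y] exI[of _ "x - y"]) simp
    qed
  qed
  ultimately show ?thesis
    unfolding real_complemented_in_def
    using assms(7-9) by (intro conjI exI[of _ N]) (auto simp: N_def)
qed

section \<open>Operator matrices\<close>

lift_definition inl_blinfun :: "'a::real_normed_vector \<Rightarrow>\<^sub>L ('a \<times> 'b::real_normed_vector)"
  is "\<lambda>x. (x, 0)"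
  by (intro bounded_linear_Pair bounded_linear_ident bounded_linear_zero)

lift_definition inr_blinfun :: "'b::real_normed_vector \<Rightarrow>\<^sub>L ('a::real_normed_vector \<times> 'b)"
  is "\<lambda>x. (0, x)"
  by (intro bounded_linear_Pair bounded_linear_ident bounded_linear_zero)

lemmas [simp] = inl_blinfun.rep_eq inr_blinfun.rep_eq

definition entry11 :: "(('a::real_normed_vector \<times> 'a) \<Rightarrow>\<^sub>L ('a \<times> 'a)) \<Rightarrow> 'a \<Rightarrow>\<^sub>L 'a"
  where "entry11 B = fst_blinfun o\<^sub>L B o\<^sub>L inl_blinfun"
definition entry12 :: "(('a::real_normed_vector \<times> 'a) \<Rightarrow>\<^sub>L ('a \<times> 'a)) \<Rightarrow> 'a \<Rightarrow>\<^sub>L 'a"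
  where "entry12 B = fst_blinfun o\<^sub>L B o\<^sub>L inr_blinfun"
definition entry21 :: "(('a::real_normed_vector \<times> 'a) \<Rightarrow>\<^sub>L ('a \<times> 'a)) \<Rightarrow> 'a \<Rightarrow>\<^sub>L 'a"
  where "entry21 B = snd_blinfun o\<^sub>L B o\<^sub>L inl_blinfun"
definition entry22 :: "(('a::real_normed_vector \<times> 'a) \<Rightarrow>\<^sub>L ('a \<times> 'a)) \<Rightarrow> 'a \<Rightarrow>\<^sub>L 'a"
  where "entry22 B = snd_blinfun o\<^sub>L B o\<^sub>L inr_blinfun"

lemmas entry_defs = entry11_def entry12_def entry21_def entry22_def

lemma bounded_linear_entry:
  "bounded_linear entry11" "bounded_linear entry12" "bounded_linear entry21" "bounded_linear entry22"
  unfolding entry_defs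
  by (rule bounded_linear_compose[OF
        bounded_bilinear.bounded_linear_left[OF bounded_bilinear_blinfun_compose]
        bounded_bilinear.bounded_linear_right[OF bounded_bilinear_blinfun_compose]])+

lemma entry_apply:
  fixes B :: "('a::real_normed_vector \<times> 'a) \<Rightarrow>\<^sub>L ('a \<times> 'a)"
  shows
  "entry11 B x = fst (B (x, 0))" "entry12 B y = fst (B (0, y))"
  "entry21 B x = snd (B (x, 0))" "entry22 B y = snd (B (0, y))"
  by (simp_all add: entry_defs)

lemma entry_block_op [simp]:
  "entry11 (block_op P Q R S) = P" "entry12 (block_op P Q R S) = Q"
  "entry21 (block_op P Q R S) = R" "entry22 (block_op P Q R S) = S"
  by (rule blinfun_eqI, simp add: entry_apply block_op.rep_eq)+

lemma block_op_eq_iff: "block_op P Q R S = block_op P' Q' R' S' \<longleftrightarrow> P = P' \<and> Q = Q' \<and> R = R' \<and> S = S'"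
  using entry_block_op by metis

lemma block_op_entries [simp]: "block_op (entry11 B) (entry12 B) (entry21 B) (entry22 B) = B"
  for B :: "('a::real_normed_vector \<times> 'a) \<Rightarrow>\<^sub>L ('a \<times> 'a)"
proof (rule blinfun_eqI)
  fix p :: "'a \<times> 'a"
  have "B p = B (fst p, 0) + B (0, snd p)"
    by (simp add: blinfun.add_right[symmetric])
  then show "block_op (entry11 B) (entry12 B) (entry21 B) (entry22 B) p = B p"
    by (simp add: block_op.rep_eq entry_apply prod_eq_iff)
qed

lemma bounded_linear_block_op_diag:
  "bounded_linear (\<lambda>(P :: 'a::real_normed_vector \<Rightarrow>\<^sub>L 'a, S). block_op P 0 0 S)"
proof -
  have "(\<lambda>(P :: 'a \<Rightarrow>\<^sub>L 'a, S). block_op P 0 0 S) =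
      (\<lambda>p. (inl_blinfun o\<^sub>L fst p o\<^sub>L fst_blinfun) + (inr_blinfun o\<^sub>L snd p o\<^sub>L snd_blinfun))"
    by (intro ext blinfun_eqI)
      (auto simp: block_op.rep_eq blinfun.add_left)
  moreover have "bounded_linear \<dots>"
    by (intro bounded_linear_add
      bounded_linear_compose[OF bounded_bilinear.bounded_linear_left[OF bounded_bilinear_blinfun_compose]]
      bounded_linear_compose[OF bounded_bilinear.bounded_linear_right[OF bounded_bilinear_blinfun_compose]]
      bounded_linear_fst bounded_linear_snd)
  ultimately show ?thesis by simp
qed

lemma entry_cbounded_ops:
  fixes B :: "('a::chilbert_space \<times> 'a) \<Rightarrow>\<^sub>L ('a \<times> 'a)"
  assumes "B \<in> cbounded_ops"
  shows "entry11 B \<in> cbounded_ops" "entry12 B \<in> cbounded_ops"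
    "entry21 B \<in> cbounded_ops" "entry22 B \<in> cbounded_ops"
proof -
  have "(c *\<^sub>C x, 0::'a) = c *\<^sub>C (x, 0)" "(0::'a, c *\<^sub>C x) = c *\<^sub>C (0, x)" for c and x :: 'a
    by (simp_all add: scaleC_prod_def)
  then show "entry11 B \<in> cbounded_ops" "entry12 B \<in> cbounded_ops"
    "entry21 B \<in> cbounded_ops" "entry22 B \<in> cbounded_ops"
    by (simp_all add: cbounded_ops_def entry_apply cbounded_opsD[OF assms])
      (simp_all add: scaleC_prod_def)
qed

lemma block_op_cbounded_ops:
  fixes P :: "'a::chilbert_space \<Rightarrow>\<^sub>L 'a"
  assumes "P \<in> cbounded_ops" "Q \<in> cbounded_ops" "R \<in> cbounded_ops" "S \<in> cbounded_ops"
  shows "block_op P Q R S \<in> cbounded_ops"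
  using assms
  by (simp add: cbounded_ops_def block_op.rep_eq scaleC_prod_def scaleC_add_right)

lemma entry_scaleC:
  fixes B :: "('a::chilbert_space \<times> 'a) \<Rightarrow>\<^sub>L ('a \<times> 'a)"
  shows
  "entry11 (c *\<^sub>C B) = c *\<^sub>C entry11 B" "entry12 (c *\<^sub>C B) = c *\<^sub>C entry12 B"
  "entry21 (c *\<^sub>C B) = c *\<^sub>C entry21 B" "entry22 (c *\<^sub>C B) = c *\<^sub>C entry22 B"
  by (rule blinfun_eqI, simp add: entry_apply scaleC_blinfun.rep_eq scaleC_prod_def)+

lemma blinfun_compose_scaleC_left: "(c *\<^sub>C B) o\<^sub>L T = c *\<^sub>C (B o\<^sub>L T)"
  by (rule blinfun_eqI) (simp add: scaleC_blinfun.rep_eq)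

lemma blinfun_compose_scaleC_right:
  "T \<in> cbounded_ops \<Longrightarrow> T o\<^sub>L (c *\<^sub>C B) = c *\<^sub>C (T o\<^sub>L B)"
  by (rule blinfun_eqI) (simp add: scaleC_blinfun.rep_eq cbounded_opsD)

lemmas blinfun_compose_simps =
  bounded_bilinear.add_left[OF bounded_bilinear_blinfun_compose]
  bounded_bilinear.add_right[OF bounded_bilinear_blinfun_compose]
  bounded_bilinear.diff_left[OF bounded_bilinear_blinfun_compose]
  bounded_bilinear.diff_right[OF bounded_bilinear_blinfun_compose]
  bounded_bilinear.scaleR_left[OF bounded_bilinear_blinfun_compose]
  bounded_bilinear.scaleR_right[OF bounded_bilinear_blinfun_compose]
  blinfun_compose_scaleC_left blinfun_compose_scaleC_right

section \<open>The commutant as a complexification\<close>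

lemma symmetric_ops_eq:
  fixes A :: "'a::chilbert_space \<Rightarrow>\<^sub>L 'a"
  shows "symmetric_ops A = {B \<in> cbounded_ops. blinfun_adjoint B o\<^sub>L A = A o\<^sub>L B}"
  by (auto simp: symmetric_ops_def cadjoint_eq_blinfun_adjoint)

lemma subspace_symmetric_ops:
  fixes A :: "'a::chilbert_space \<Rightarrow>\<^sub>L 'a"
  shows "subspace (symmetric_ops A)"
  using subspace_cbounded_ops[where ?'a='a]
  by (auto simp: symmetric_ops_eq subspace_def blinfun_adjoint_zero blinfun_adjoint_add
      blinfun_adjoint_scaleR blinfun_compose_simps)

lemma closed_symmetric_ops:
  fixes A :: "'a::chilbert_space \<Rightarrow>\<^sub>L 'a"
  shows "closed (symmetric_ops A)"
proof -
  have "symmetric_ops A = cbounded_ops \<inter> {B. blinfun_adjoint B o\<^sub>L A = A o\<^sub>L B}"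
    by (auto simp: symmetric_ops_eq)
  also have "closed \<dots>"
    by (intro closed_Int closed_cbounded_ops closed_Collect_eq
        bounded_bilinear.continuous_on[OF bounded_bilinear_blinfun_compose]
        bounded_linear.continuous_on[OF bounded_linear_blinfun_adjoint] continuous_intros)
  finally show ?thesis .
qed

lemma csubspace_commutant:
  assumes "T \<in> cbounded_ops"
  shows "csubspace (commutant T)"
  using csubspace_cbounded_ops assms
  by (auto simp: commutant_def csubspace_def blinfun_compose_simps)

lemma closed_commutant: "closed (commutant T)"
proof -
  have "commutant T = cbounded_ops \<inter> {B. B o\<^sub>L T = T o\<^sub>L B}"
    by (auto simp: commutant_def)
  also have "closed \<dots>"
    by (intro closed_Int closed_cbounded_ops closed_Collect_eq
        bounded_bilinear.continuous_on[OF bounded_bilinear_blinfun_compose] continuous_intros)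
  finally show ?thesis .
qed

text \<open>
  The two products have rows \<open>0, P A\<close> and \<open>0, R A\<close>, respectively \<open>A R, A S\<close> and \<open>0, 0\<close>; injectivity of
  \<open>A\<close> turns \<open>A R = 0\<close> into \<open>R = 0\<close>.
\<close>
lemma commutant_corner_iff:
  fixes A :: "'a::chilbert_space \<Rightarrow>\<^sub>L 'a"
  assumes "\<And>x. A x = 0 \<Longrightarrow> x = 0"
  shows "B \<in> commutant (block_op 0 A 0 0) \<longleftrightarrow>
    B \<in> cbounded_ops \<and> entry21 B = 0 \<and> entry11 B o\<^sub>L A = A o\<^sub>L entry22 B"
    (is "_ \<longleftrightarrow> _ \<and> ?R")
proof -
  have "B o\<^sub>L block_op 0 A 0 0 = block_op 0 A 0 0 o\<^sub>L B \<longleftrightarrow> ?R"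
  proof -
    obtain P Q R S where B: "B = block_op P Q R S" by (metis block_op_entries)
    have l: "B o\<^sub>L block_op 0 A 0 0 = block_op 0 (P o\<^sub>L A) 0 (R o\<^sub>L A)"
      by (rule blinfun_eqI) (simp add: B block_op.rep_eq)
    have r: "block_op 0 A 0 0 o\<^sub>L B = block_op (A o\<^sub>L R) (A o\<^sub>L S) 0 0"
      by (rule blinfun_eqI) (simp add: B block_op.rep_eq blinfun.add_right)
    have "A o\<^sub>L R = 0 \<longleftrightarrow> R = 0"
      using assms by (auto intro!: blinfun_eqI dest!: arg_cong[of _ _ blinfun_apply] simp: fun_eq_iff)
    then show ?thesis
      unfolding l r block_op_eq_iff by (auto simp: B)
  qed
  then show ?thesis by (simp add: commutant_def)
qed

text \<open>
  The involution \<open>(P, S) \<mapsto> (S\<^sup>*, P\<^sup>*)\<close> on the diagonals of operator matrices has as fixed points the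
  pairs \<open>(X\<^sup>*, X)\<close>.  They are parametrised by \<open>X\<close>, so the fixed part of a diagonal, its mean with its
  image under the involution, is recorded by the lower right entry.
\<close>
definition hermitian_part ::
    "(('a::{real_inner,complete_space} \<times> 'a) \<Rightarrow>\<^sub>L ('a \<times> 'a)) \<Rightarrow> 'a \<Rightarrow>\<^sub>L 'a"
  where "hermitian_part B = (1/2) *\<^sub>R (entry22 B + blinfun_adjoint (entry11 B))"

definition hermitian_lift ::
    "('a::{real_inner,complete_space} \<Rightarrow>\<^sub>L 'a) \<Rightarrow> ('a \<times> 'a) \<Rightarrow>\<^sub>L ('a \<times> 'a)"
  where "hermitian_lift X = block_op (blinfun_adjoint X) 0 0 X"

lemma bounded_linear_hermitian_part: "bounded_linear hermitian_part"
  unfolding hermitian_part_def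
  by (intro bounded_linear_const_scaleR bounded_linear_add bounded_linear_entry
      bounded_linear_compose[OF bounded_linear_blinfun_adjoint])

lemma bounded_linear_hermitian_lift: "bounded_linear hermitian_lift"
  unfolding hermitian_lift_def
  using bounded_linear_compose[OF bounded_linear_block_op_diag
      bounded_linear_Pair[OF bounded_linear_blinfun_adjoint bounded_linear_ident]]
  by simp

lemma hermitian_part_cbounded_ops:
  fixes B :: "('a::chilbert_space \<times> 'a) \<Rightarrow>\<^sub>L ('a \<times> 'a)"
  shows "B \<in> cbounded_ops \<Longrightarrow> hermitian_part B \<in> cbounded_ops"
  unfolding hermitian_part_def
  by (intro subspace_mul subspace_add subspace_cbounded_ops entry_cbounded_ops blinfun_adjoint_cbounded_ops)

lemma hermitian_lift_cbounded_ops: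
  fixes X :: "'a::chilbert_space \<Rightarrow>\<^sub>L 'a"
  shows "X \<in> cbounded_ops \<Longrightarrow> hermitian_lift X \<in> cbounded_ops"
  unfolding hermitian_lift_def
  by (intro block_op_cbounded_ops blinfun_adjoint_cbounded_ops subspace_0 subspace_cbounded_ops)

lemma hermitian_part_lift [simp]: "hermitian_part (hermitian_lift X) = X"
  by (simp add: hermitian_part_def hermitian_lift_def scaleR_2[symmetric])

lemma hermitian_part_ii:
  fixes B :: "('a::chilbert_space \<times> 'a) \<Rightarrow>\<^sub>L ('a \<times> 'a)"
  assumes "B \<in> cbounded_ops"
  shows "hermitian_part (\<i> *\<^sub>C B) = (1/2) *\<^sub>R (\<i> *\<^sub>C (entry22 B - blinfun_adjoint (entry11 B)))"
  by (simp add: hermitian_part_def entry_scaleC blinfun_adjoint_scaleC entry_cbounded_ops assms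
      scaleC_diff_right)

lemma hermitian_part_ii_lift:
  fixes X :: "'a::chilbert_space \<Rightarrow>\<^sub>L 'a"
  shows "X \<in> cbounded_ops \<Longrightarrow> hermitian_part (\<i> *\<^sub>C hermitian_lift X) = 0"
  by (simp add: hermitian_part_ii hermitian_lift_cbounded_ops) (simp add: hermitian_lift_def)

text \<open>
  A vector is recovered from the real parts of itself and of its multiple by \<open>\<i>\<close>, as
  \<open>z = Re z - \<i> Re (\<i> z)\<close> for a complex number.
\<close>
lemma diagonal_from_hermitian_parts:
  fixes B :: "('a::chilbert_space \<times> 'a) \<Rightarrow>\<^sub>L ('a \<times> 'a)"
  assumes "B \<in> cbounded_ops"
  shows "entry22 B = hermitian_part B - \<i> *\<^sub>C hermitian_part (\<i> *\<^sub>C B)"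
    and "blinfun_adjoint (entry11 B) = hermitian_part B + \<i> *\<^sub>C hermitian_part (\<i> *\<^sub>C B)"
proof -
  have half: "(1/2) *\<^sub>R (a + b) + (1/2) *\<^sub>R (a - b) = a" for a b :: "'a \<Rightarrow>\<^sub>L 'a"
  proof -
    have "(a + b) + (a - b) = a + a" by simp
    then show ?thesis
      by (metis scaleR_add_right scaleR_half_double)
  qed
  let ?P = "blinfun_adjoint (entry11 B)" and ?S = "entry22 B"
  have ii: "\<i> *\<^sub>C hermitian_part (\<i> *\<^sub>C B) = - ((1/2) *\<^sub>R (?S - ?P))"
    by (simp only: hermitian_part_ii[OF assms] scaleC_simps scaleC_ii_ii scaleR_minus_right)
  also have "\<dots> = (1/2) *\<^sub>R (?P - ?S)"
    by (simp only: scaleR_minus_right[symmetric] minus_diff_eq)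
  finally have ii': "\<i> *\<^sub>C hermitian_part (\<i> *\<^sub>C B) = (1/2) *\<^sub>R (?P - ?S)" .
  show "?S = hermitian_part B - \<i> *\<^sub>C hermitian_part (\<i> *\<^sub>C B)"
    unfolding ii hermitian_part_def[of B] diff_minus_eq_add by (rule half[symmetric])
  show "?P = hermitian_part B + \<i> *\<^sub>C hermitian_part (\<i> *\<^sub>C B)"
    unfolding ii' hermitian_part_def[of B] add.commute[of ?S ?P] by (rule half[symmetric])
qed

text \<open>
  Taking adjoints in \<open>P A = A S\<close> gives \<open>S\<^sup>* A = A P\<^sup>*\<close>; adding the two equations shows that
  the hermitian part is \<open>A\<close>-symmetric, and the same applies to \<open>\<i> B\<close>, which commutes as well.
  Conversely, \<open>P = X\<^sup>* - \<i> Y\<^sup>*\<close> and \<open>S = X - \<i> Y\<close> for the two hermitian parts \<open>X\<close> and \<open>Y\<close>, so that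
  their symmetry gives \<open>P A = A S\<close>.
\<close>
lemma commutant_iff_hermitian_parts:
  fixes A :: "'a::chilbert_space \<Rightarrow>\<^sub>L 'a"
  assumes "A \<in> cbounded_ops" "blinfun_adjoint A = A" "\<And>x. A x = 0 \<Longrightarrow> x = 0"
  shows "B \<in> commutant (block_op 0 A 0 0) \<longleftrightarrow>
    B \<in> cbounded_ops \<and> entry21 B = 0 \<and>
    hermitian_part B \<in> symmetric_ops A \<and> hermitian_part (\<i> *\<^sub>C B) \<in> symmetric_ops A"
    (is "_ \<longleftrightarrow> ?R B")
proof
  let ?T = "block_op 0 A 0 0"
  have part: "hermitian_part C \<in> symmetric_ops A" if C: "C \<in> commutant ?T" for C
  proof -
    have cb: "C \<in> cbounded_ops" and eq: "entry11 C o\<^sub>L A = A o\<^sub>L entry22 C"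
      using C commutant_corner_iff[OF assms(3)] by auto
    have "A o\<^sub>L blinfun_adjoint (entry11 C) = blinfun_adjoint (entry22 C) o\<^sub>L A"
      using arg_cong[OF eq, of blinfun_adjoint] by (simp add: blinfun_adjoint_compose assms(2))
    then show ?thesis
      using hermitian_part_cbounded_ops[OF cb]
      by (simp add: symmetric_ops_eq hermitian_part_def blinfun_adjoint_add blinfun_adjoint_scaleR
          blinfun_compose_simps eq add.commute)
  qed
  have "?T \<in> cbounded_ops"
    by (intro block_op_cbounded_ops assms(1) subspace_0 subspace_cbounded_ops)
  then have "\<i> *\<^sub>C B \<in> commutant ?T" if "B \<in> commutant ?T"
    using that csubspace_commutant unfolding csubspace_def by blast
  then show "?R B" if "B \<in> commutant ?T"
    using that part commutant_corner_iff[OF assms(3)] by blast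
next
  assume R: "?R B"
  define X Y where "X = hermitian_part B" and "Y = hermitian_part (\<i> *\<^sub>C B)"
  have X: "X \<in> cbounded_ops" "blinfun_adjoint X o\<^sub>L A = A o\<^sub>L X"
    and Y: "Y \<in> cbounded_ops" "blinfun_adjoint Y o\<^sub>L A = A o\<^sub>L Y"
    using R by (auto simp: X_def Y_def symmetric_ops_eq)
  have "B \<in> cbounded_ops" using R by simp
  note diagonal = diagonal_from_hermitian_parts[OF this, folded X_def Y_def]
  have "entry11 B = blinfun_adjoint X - \<i> *\<^sub>C blinfun_adjoint Y"
    using arg_cong[OF diagonal(2), of blinfun_adjoint]
    by (simp add: blinfun_adjoint_add blinfun_adjoint_scaleC Y(1))
  then have "entry11 B o\<^sub>L A = A o\<^sub>L entry22 B"
    by (simp add: diagonal(1) blinfun_compose_simps X(2) Y(2) assms(1))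
  then show "B \<in> commutant (block_op 0 A 0 0)"
    using R commutant_corner_iff[OF assms(3)] by blast
qed

text \<open>
  The complement is the complexification of \<open>N\<close> on the diagonal, together with the matrices whose only
  nonzero entry is the lower left one.  It is closed as a preimage under continuous maps.
\<close>
lemma complex_complemented_if_real_complemented:
  fixes A :: "'a::chilbert_space \<Rightarrow>\<^sub>L 'a"
  assumes "A \<in> cbounded_ops" "blinfun_adjoint A = A" "\<And>x. A x = 0 \<Longrightarrow> x = 0"
    and "real_complemented_in cbounded_ops (symmetric_ops A)"
  shows "complex_complemented_in cbounded_ops (commutant (block_op 0 A 0 0))"
proof -
  let ?M = "commutant (block_op 0 A 0 0)"
  note M_iff = commutant_iff_hermitian_parts[OF assms(1-3)]
  interpret h: bounded_linear "hermitian_part :: (('a \<times> 'a) \<Rightarrow>\<^sub>L ('a \<times> 'a)) \<Rightarrow> _"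
    by (rule bounded_linear_hermitian_part)
  interpret e12: bounded_linear "entry12 :: (('a \<times> 'a) \<Rightarrow>\<^sub>L ('a \<times> 'a)) \<Rightarrow> _"
    by (rule bounded_linear_entry)
  interpret e21: bounded_linear "entry21 :: (('a \<times> 'a) \<Rightarrow>\<^sub>L ('a \<times> 'a)) \<Rightarrow> _"
    by (rule bounded_linear_entry)
  obtain N where N: "N \<subseteq> cbounded_ops" "closed N" "subspace N" "symmetric_ops A \<inter> N = {0}"
    and sum: "{m + n | m n. m \<in> symmetric_ops A \<and> n \<in> N} = cbounded_ops"
    using assms(4) unfolding real_complemented_in_def by blast
  define N' where "N' = {B \<in> cbounded_ops. entry12 B = 0 \<and> hermitian_part B \<in> N \<and> hermitian_part (\<i> *\<^sub>C B) \<in> N}"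
  have T: "block_op 0 A 0 0 \<in> cbounded_ops"
    by (intro block_op_cbounded_ops assms(1) subspace_0 subspace_cbounded_ops)
  have "closed N'"
  proof -
    have "N' = cbounded_ops \<inter> {B. entry12 B = 0} \<inter> (hermitian_part -` N) \<inter> ((\<lambda>B. hermitian_part (\<i> *\<^sub>C B)) -` N)"
      by (auto simp: N'_def)
    also have "closed \<dots>"
      by (intro closed_Int closed_cbounded_ops closed_Collect_eq closed_vimage N(2)
          e12.continuous_on h.continuous_on bounded_linear.continuous_on[OF bounded_linear_scaleC]
          continuous_intros)
    finally show ?thesis .
  qed
  have "csubspace N'"
  proof (rule csubspaceI)
    show "subspace N'"
      using subspace_cbounded_ops[where ?'a="'a \<times> 'a"] N(3)
      by (auto simp: N'_def subspace_def h.zero h.add h.scaleR e12.zero e12.add e12.scaleR scaleC_add_right)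
    show "\<i> *\<^sub>C B \<in> N'" if "B \<in> N'" for B
      using that subspace_neg[OF N(3)]
      by (auto simp: N'_def scaleC_cbounded_ops entry_scaleC h.neg)
  qed
  have "?M \<inter> N' \<subseteq> {0}"
  proof
    fix B assume B: "B \<in> ?M \<inter> N'"
    then have cb: "B \<in> cbounded_ops" and e: "entry12 B = 0" "entry21 B = 0"
      and parts: "hermitian_part B = 0" "hermitian_part (\<i> *\<^sub>C B) = 0"
      using M_iff N(4) by (auto simp: N'_def)
    have "entry22 B = 0" "blinfun_adjoint (entry11 B) = 0"
      using diagonal_from_hermitian_parts[OF cb] parts by simp_all
    then have "entry11 B = 0" "entry22 B = 0"
      using blinfun_adjoint_zero blinfun_adjoint_adjoint by metis+
    then have "B = block_op 0 0 0 0"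
      using block_op_entries[of B] e by simp
    also have "\<dots> = 0" by (rule blinfun_eqI) (simp add: block_op.rep_eq zero_prod_def)
    finally show "B \<in> {0}" by simp
  qed
  moreover have "cbounded_ops \<subseteq> {m + n | m n. m \<in> ?M \<and> n \<in> N'}"
  proof
    fix B :: "('a \<times> 'a) \<Rightarrow>\<^sub>L ('a \<times> 'a)" assume B: "B \<in> cbounded_ops"
    have "hermitian_part B \<in> cbounded_ops" "hermitian_part (\<i> *\<^sub>C B) \<in> cbounded_ops"
      using B by (intro hermitian_part_cbounded_ops scaleC_cbounded_ops; assumption)+
    then obtain x y u v where x: "x \<in> symmetric_ops A" "u \<in> N" "hermitian_part B = x + u"
      and y: "y \<in> symmetric_ops A" "v \<in> N" "hermitian_part (\<i> *\<^sub>C B) = y + v"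
      using sum by blast
    have cb: "x \<in> cbounded_ops" "y \<in> cbounded_ops"
      using x(1) y(1) by (simp_all add: symmetric_ops_def)
    define q where "q = block_op 0 (entry12 B) 0 0"
    have q: "q \<in> cbounded_ops" "hermitian_part q = 0" "hermitian_part (\<i> *\<^sub>C q) = 0"
    proof -
      show cq: "q \<in> cbounded_ops" unfolding q_def
        by (intro block_op_cbounded_ops subspace_0 subspace_cbounded_ops entry_cbounded_ops B)
      show "hermitian_part q = 0" by (simp add: q_def hermitian_part_def blinfun_adjoint_zero)
      show "hermitian_part (\<i> *\<^sub>C q) = 0"
        by (simp add: hermitian_part_ii[OF cq]) (simp add: q_def blinfun_adjoint_zero)
    qed
    \<comment> \<open>The element of the commutant with hermitian parts \<open>x\<close> and \<open>y\<close> that agrees with \<open>B\<close> in the upper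
      right entry.\<close>
    define m where "m = hermitian_lift x - \<i> *\<^sub>C hermitian_lift y + q"
    have "m \<in> cbounded_ops" unfolding m_def
      by (intro subspace_add subspace_diff subspace_cbounded_ops scaleC_cbounded_ops
          hermitian_lift_cbounded_ops cb q)
    moreover have "entry21 m = 0" "entry12 m = entry12 B"
      by (simp_all add: m_def e21.add e21.diff e12.add e12.diff entry_scaleC q_def hermitian_lift_def)
    moreover have "hermitian_part m = x"
      by (simp add: m_def h.add h.diff q hermitian_part_ii_lift cb)
    moreover have "hermitian_part (\<i> *\<^sub>C m) = y"
      by (simp add: m_def scaleC_add_right scaleC_diff_right h.add h.diff h.neg q hermitian_part_ii_lift cb)
    ultimately have "m \<in> ?M" "B - m \<in> N'"
      using x y B
      by (simp_all add: M_iff N'_def subspace_diff[OF subspace_cbounded_ops] e12.diff h.diff scaleC_diff_right)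
    then show "B \<in> {m + n | m n. m \<in> ?M \<and> n \<in> N'}"
      by (intro CollectI exI[of _ m] exI[of _ "B - m"]) simp
  qed
  moreover have "?M \<subseteq> cbounded_ops" "N' \<subseteq> cbounded_ops" by (auto simp: commutant_def N'_def)
  moreover have "{m + n | m n. m \<in> ?M \<and> n \<in> N'} \<subseteq> cbounded_ops"
    using calculation(3,4) subspace_add[OF subspace_cbounded_ops[where ?'a="'a \<times> 'a"]] by blast
  moreover have "0 \<in> ?M" "0 \<in> N'"
    using csubspace_commutant[OF T] \<open>csubspace N'\<close> by (simp_all add: csubspace_def)
  ultimately show ?thesis
    unfolding complex_complemented_in_def
    using closed_commutant csubspace_commutant[OF T] \<open>closed N'\<close> \<open>csubspace N'\<close>
    by (intro conjI exI[of _ N']) auto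
qed

lemma real_complemented_if_complex_complemented:
  fixes A :: "'a::chilbert_space \<Rightarrow>\<^sub>L 'a"
  assumes "A \<in> cbounded_ops" "blinfun_adjoint A = A" "\<And>x. A x = 0 \<Longrightarrow> x = 0"
    and "complex_complemented_in cbounded_ops (commutant (block_op 0 A 0 0))"
  shows "real_complemented_in cbounded_ops (symmetric_ops A)"
proof (rule real_complemented_in_retract[OF bounded_linear_hermitian_part bounded_linear_hermitian_lift])
  note M_iff = commutant_iff_hermitian_parts[OF assms(1-3)]
  show "real_complemented_in cbounded_ops (commutant (block_op 0 A 0 0))"
    by (rule real_complemented_if_complex_complemented_in[OF assms(4)])
  show "symmetric_ops A \<subseteq> cbounded_ops" by (auto simp: symmetric_ops_def)
  show "hermitian_lift x \<in> commutant (block_op 0 A 0 0)" if "x \<in> symmetric_ops A" for x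
  proof -
    have "x \<in> cbounded_ops" using that by (simp add: symmetric_ops_def)
    then have "hermitian_lift x \<in> cbounded_ops" "hermitian_part (\<i> *\<^sub>C hermitian_lift x) = 0"
      by (rule hermitian_lift_cbounded_ops, rule hermitian_part_ii_lift)
    moreover have "entry21 (hermitian_lift x) = 0" by (simp add: hermitian_lift_def)
    ultimately show ?thesis
      using that subspace_0[OF subspace_symmetric_ops] by (simp add: M_iff)
  qed
  show "hermitian_part B \<in> symmetric_ops A" if "B \<in> commutant (block_op 0 A 0 0)" for B
    using that M_iff by blast
qed (simp_all add: closed_cbounded_ops subspace_cbounded_ops closed_symmetric_ops
    subspace_symmetric_ops hermitian_lift_cbounded_ops)

theorem theorem2p5:
  fixes A :: "'a::chilbert_space \<Rightarrow>\<^sub>L 'a"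
  assumes "A \<in> cbounded_ops"
    and "op_le 0 A" and "op_le A id_blinfun"
    and "{x. blinfun_apply A x = 0} = {0}"
  shows "real_complemented_in cbounded_ops (symmetric_ops A) \<longleftrightarrow>
         complex_complemented_in cbounded_ops (commutant (block_op 0 A 0 0))"
proof -
  have self_adjoint: "blinfun_adjoint A = A"
    by (rule blinfun_adjoint_eq_if_op_le[OF assms(1,2)])
  have injective: "x = 0" if "A x = 0" for x
    using assms(4) that by (simp add: set_eq_iff)
  show ?thesis
  proof
    assume "real_complemented_in cbounded_ops (symmetric_ops A)"
    with assms(1) self_adjoint injective
    show "complex_complemented_in cbounded_ops (commutant (block_op 0 A 0 0))"
      by (rule complex_complemented_if_real_complemented)
  next
    assume "complex_complemented_in cbounded_ops (commutant (block_op 0 A 0 0))"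
    with assms(1) self_adjoint injective
    show "real_complemented_in cbounded_ops (symmetric_ops A)"
      by (rule real_complemented_if_complex_complemented)
  qed
qed

end
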